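(* The fractal structure in Pascal's triangle modulo $2$ is as follows. The set of cells $(n,i,j)$, with $i,j$ natural numbers and $n=i+j$, whose entry $\dfrac{n!}{i!\,j!}$ is even is a union of lattices of triangles, each lattice being the intersection of stripes. These lattices correspond to the place positions $k$: the lattice for position $k$ consists of the cells with $i_k=0$, $j_k=0$ and $n_k=1$, that is, it is the intersection of the horizontal stripes $\{n_k=1\}$ with the two families of diagonal stripes $\{i_k=0\}$ and $\{j_k=0\}$ (for the 1's place, $k=0$, this intersection is empty). Their union is thus the set of locations $\dfrac{n!}{i!\,j!}$ in Pascal's triangle for which, in some place position, $i$ and $j$ have a bit $0$ and $n$ has a bit $1$; in other words, it is the set of locations for which there is a carry in the binary addition $i+j=n$; and in turn these are precisely the locations at which the value $\dfrac{n!}{i!\,j!}$ is even.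
   Context: Natural numbers are $\{0,1,2,\dots\}$. Pascal's triangle is drawn with the cell at position $(n,i,j)$, $n=i+j$, holding the entry $\frac{n!}{i!\,j!}$; $n$ counts the (horizontal) rows, $i$ counts the NW-SE diagonals, and $j$ counts the NE-SW diagonals. For a natural number $m$, $m_k\in\{0,1\}$ denotes its $k$th binary digit (bit), so $m=\sum_{k\ge 0}m_k2^k$; position $k$ is the $2^k$'s place. For fixed $k$, the conditions $n_k=1$, $i_k=0$ and $j_k=0$ each select a periodic family of stripes of cells: horizontal stripes made of rows, stripes made of NW-SE diagonals, and stripes made of NE-SW diagonals, respectively. A lattice of triangles is a periodic arrangement in the triangle of translated copies of one triangular block of cells. A carry in $i+j=n$ means a carry in the usual digit-by-digit addition algorithm in base $2$. *)

theory Defs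
  imports Complex_Main "HOL-Library.Disjoint_Sets"
begin

text \<open>The bit \<open>m\<^sub>k\<close> is the library's \<^term>\<open>bit m k\<close>, with \<open>m\<^sub>k = 1\<close> read as
  \<^term>\<open>bit m k\<close> and \<open>m\<^sub>k = 0\<close> as its negation.\<close>

type_synonym cell = "nat \<times> nat \<times> nat"

definition cells :: "cell set" where
  "cells = {(n, i, j). n = i + j}"

fun row_index :: "cell \<Rightarrow> nat" where "row_index (n, i, j) = n"
fun nwse_index :: "cell \<Rightarrow> nat" where "nwse_index (n, i, j) = i"
fun nesw_index :: "cell \<Rightarrow> nat" where "nesw_index (n, i, j) = j"

text \<open>On \<^const>\<open>cells\<close> the division is exact, see \<open>entry_exact\<close> below.\<close>

fun entry :: "cell \<Rightarrow> nat" where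
  "entry (n, i, j) = fact n div (fact i * fact j)"

lemma entry_exact:
  assumes "(n, i, j) \<in> cells"
  shows "entry (n, i, j) * (fact i * fact j) = fact n"
    and "entry (n, i, j) = n choose i"
proof -
  have n: "n = i + j" using assms by (simp add: cells_def)
  have *: "fact i * fact j * (n choose i) = (fact n :: nat)"
    using binomial_fact_lemma[of i n] n by simp
  have "entry (n, i, j) = (fact i * fact j * (n choose i)) div (fact i * fact j)"
    by (simp only: entry.simps *)
  then show e: "entry (n, i, j) = n choose i"
    by simp
  show "entry (n, i, j) * (fact i * fact j) = fact n"
    unfolding e using * by (simp only: mult.commute)
qed

subsection \<open>Stripes\<close>

text \<open>Here \<open>f\<close> is one of the three index functions, so that a stripe is a band of \<open>w\<close> consecutive
  lines \<open>f = const\<close>; consecutive stripes start \<open>p\<close> lines apart, and \<open>w < p\<close> keeps them separated.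
  The condition \<open>a + w \<le> p\<close> says that the first stripe lies in the first period.\<close>

definition periodic_stripes :: "(cell \<Rightarrow> nat) \<Rightarrow> cell set \<Rightarrow> bool" where
  "periodic_stripes f S \<longleftrightarrow>
     (\<exists>a w p. 0 < w \<and> w < p \<and> a + w \<le> p \<and>
        S = (\<Union>q. {c \<in> cells. f c \<in> {a + q * p ..< a + q * p + w}}))"

definition row_stripes :: "nat \<Rightarrow> cell set" where
  "row_stripes k = {c \<in> cells. bit (row_index c) k}"

definition nwse_stripes :: "nat \<Rightarrow> cell set" where
  "nwse_stripes k = {c \<in> cells. \<not> bit (nwse_index c) k}"

definition nesw_stripes :: "nat \<Rightarrow> cell set" where
  "nesw_stripes k = {c \<in> cells. \<not> bit (nesw_index c) k}"

subsection \<open>Lattices of triangles\<close>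

text \<open>A triangular block is bounded by one row and one diagonal of each family. It either points up
  or points down; in the latter case \<open>a \<le> c\<close> and \<open>b \<le> c\<close> say that the two upper corners
  \<open>(c, a, c - a)\<close> and \<open>(c, c - b, b)\<close> are cells, so that the block is not truncated by
  the border of Pascal's triangle. In both cases the block is nonempty.\<close>

definition up_triangle :: "cell set \<Rightarrow> bool" where
  "up_triangle T \<longleftrightarrow>
     (\<exists>a b c. a + b \<le> c \<and> T = {(n, i, j) \<in> cells. a \<le> i \<and> b \<le> j \<and> n \<le> c})"

definition down_triangle :: "cell set \<Rightarrow> bool" where
  "down_triangle T \<longleftrightarrow>
     (\<exists>a b c. a \<le> c \<and> b \<le> c \<and> c \<le> a + b \<and>
        T = {(n, i, j) \<in> cells. i \<le> a \<and> j \<le> b \<and> c \<le> n})"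

definition triangular_block :: "cell set \<Rightarrow> bool" where
  "triangular_block T \<longleftrightarrow> up_triangle T \<or> down_triangle T"

fun shift :: "nat \<Rightarrow> nat \<Rightarrow> cell \<Rightarrow> cell" where
  "shift u v (n, i, j) = (n + u + v, i + u, j + v)"

text \<open>The copies are complete and pairwise disjoint, and are repeated with one period \<open>p\<close> in the
  direction of both families of diagonals.\<close>

definition lattice_of_triangles :: "cell set \<Rightarrow> bool" where
  "lattice_of_triangles L \<longleftrightarrow>
     (\<exists>T p. triangular_block T \<and> 0 < p \<and>
        disjoint_family (\<lambda>(x, y). shift (x * p) (y * p) ` T) \<and>
        L = (\<Union>(x, y). shift (x * p) (y * p) ` T))"

definition position_lattice :: "nat \<Rightarrow> cell set" where
  "position_lattice k = {(n, i, j) \<in> cells. \<not> bit i k \<and> \<not> bit j k \<and> bit n k}"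

subsection \<open>Carries\<close>

abbreviation digit :: "nat \<Rightarrow> nat \<Rightarrow> nat" where
  "digit m k \<equiv> of_bool (bit m k)"

text \<open>\<open>carry_into i j k\<close> is the carry that the addition algorithm for \<open>i + j\<close> brings into
  position \<open>k\<close>; the digit it writes there is given by \<open>digit_add\<close> below.\<close>

fun carry_into :: "nat \<Rightarrow> nat \<Rightarrow> nat \<Rightarrow> nat" where
  "carry_into i j 0 = 0"
| "carry_into i j (Suc k) = (digit i k + digit j k + carry_into i j k) div 2"

definition has_carry :: "nat \<Rightarrow> nat \<Rightarrow> bool" where
  "has_carry i j \<longleftrightarrow> (\<exists>k. carry_into i j k = 1)"

lemma digit_eq_mod: "digit m k = (m div 2 ^ k) mod 2"
  by (simp only: bit_iff_odd mod_2_eq_odd)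

lemma carry_into_div: "(i + j) div 2 ^ k = i div 2 ^ k + j div 2 ^ k + carry_into i j k"
proof (induction k)
  case (Suc k)
  have s: "m div 2 ^ Suc k = (m div 2 ^ k) div 2" for m :: nat
    by (simp only: power_Suc2 div_mult2_eq)
  have "(a + b + c) div 2 = a div 2 + b div 2 + (a mod 2 + b mod 2 + c) div 2" for a b c :: nat
  proof -
    have "a + b + c = (x + y + c) + (q + r) * 2" if "x + q * 2 = a" "y + r * 2 = b" for x y q r
      unfolding that(1)[symmetric] that(2)[symmetric] by (simp only: distrib_right ac_simps)
    from this[OF mod_div_mult_eq mod_div_mult_eq]
    have "(a + b + c) div 2 = ((a mod 2 + b mod 2 + c) + (a div 2 + b div 2) * 2) div 2"
      by (simp only:)
    also have "\<dots> = a div 2 + b div 2 + (a mod 2 + b mod 2 + c) div 2"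
      by (subst div_mult_self1) simp_all
    finally show ?thesis .
  qed
  then show ?case
    unfolding s carry_into.simps digit_eq_mod Suc .
qed simp

lemma digit_add: "digit (i + j) k = (digit i k + digit j k + carry_into i j k) mod 2"
proof -
  have "(a + b + c) mod 2 = (a mod 2 + b mod 2 + c) mod 2" for a b c :: nat
    by (metis mod_add_eq mod_add_left_eq)
  then show ?thesis
    unfolding digit_eq_mod carry_into_div .
qed

end

theory Submission
  imports Defs
begin

text \<open>
  A number has bit \<open>k\<close> set exactly when its residue modulo \<open>2\<^sup>k\<^sup>+\<^sup>1\<close> lies in the upper half
  of the residues. This makes each stripe condition periodic, and it
  turns the condition for position \<open>k\<close> into \<open>r < 2\<^sup>k\<close>, \<open>s < 2\<^sup>k\<close> and \<open>2\<^sup>k \<le> r + s\<close> for the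
  residues \<open>r\<close> of \<open>i\<close> and \<open>s\<close> of \<open>j\<close>: a downward triangle, repeated with period \<open>2\<^sup>k\<^sup>+\<^sup>1\<close> along
  both families of diagonals (\<open>lattice_position_lattice\<close>).

  The three descriptions of the even entries are linked through carries. A chain of carries starts
  at a position where \<open>i\<close> and \<open>j\<close> both have bit \<open>1\<close>, and it ends at a position where both have bit
  \<open>0\<close> and the carry is written out as a bit \<open>1\<close> of \<open>n\<close>. The starts of the chains see the parity
  of the entry: halving \<open>n\<close> and \<open>i\<close> preserves the parity of \<open>n choose i\<close>, unless \<open>n\<close> is even
  and \<open>i\<close> odd, that is, unless \<open>i\<close> and \<open>j = n - i\<close> are both odd, and then the entry is even
  (\<open>even_choose_iff_common_bit\<close>). The ends see the lattices
  (\<open>has_carry_iff_zero_zero_one\<close>).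
\<close>

section \<open>Stripes\<close>

lemma bit_iff_upper_half: "bit m k \<longleftrightarrow> 2 ^ k \<le> m mod 2 ^ Suc k" for m :: nat
proof -
  have "m mod 2 ^ Suc k = 2 ^ k * (m div 2 ^ k mod 2) + m mod 2 ^ k"
    by (simp only: power_Suc2 mod_mult2_eq)
  moreover have "m mod 2 ^ k < 2 ^ k"
    by simp
  ultimately show ?thesis
    by (cases "even (m div 2 ^ k)") (simp_all add: bit_iff_odd even_iff_mod_2_eq_zero odd_iff_mod_2_eq_one not_le)
qed

lemma in_periodic_interval_iff:
  fixes a w p x :: nat
  assumes "a + w \<le> p"
  shows "(\<exists>q. x \<in> {a + q * p ..< a + q * p + w}) \<longleftrightarrow> x mod p \<in> {a ..< a + w}"
proof
  assume "\<exists>q. x \<in> {a + q * p ..< a + q * p + w}"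
  then obtain q where q: "a + q * p \<le> x" "x < a + q * p + w"
    by auto
  then obtain r where r: "x = r + q * p"
    by (metis add_leD2 le_add_diff_inverse2)
  with q assms have "a \<le> r" "r < a + w" "r < p"
    by auto
  with r show "x mod p \<in> {a ..< a + w}"
    by simp
next
  assume "x mod p \<in> {a ..< a + w}"
  then have "x \<in> {a + (x div p) * p ..< a + (x div p) * p + w}"
    using mod_div_mult_eq[of x p] by (simp only: atLeastLessThan_iff) linarith
  then show "\<exists>q. x \<in> {a + q * p ..< a + q * p + w}" ..
qed

lemma periodic_stripesI:
  assumes "0 < w" "w < p" "a + w \<le> p"
    and "S = {c \<in> cells. f c mod p \<in> {a ..< a + w}}"
  shows "periodic_stripes f S"
proof -
  have "S = (\<Union>q. {c \<in> cells. f c \<in> {a + q * p ..< a + q * p + w}})"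
    unfolding assms(4) in_periodic_interval_iff[OF assms(3), symmetric] by blast
  with assms(1-3) show ?thesis
    unfolding periodic_stripes_def by blast
qed

lemma periodic_stripes_bit: "periodic_stripes f {c \<in> cells. bit (f c) k}"
proof (rule periodic_stripesI[of "2 ^ k" "2 ^ Suc k" "2 ^ k"])
  have "x mod 2 ^ Suc k < 2 ^ k + 2 ^ k" for x :: nat
  proof -
    have "x mod 2 ^ Suc k < 2 ^ Suc k"
      by simp
    then show ?thesis
      by (simp only: power_Suc mult_2)
  qed
  then show "{c \<in> cells. bit (f c) k} = {c \<in> cells. f c mod 2 ^ Suc k \<in> {2 ^ k ..< 2 ^ k + 2 ^ k}}"
    by (simp only: bit_iff_upper_half atLeastLessThan_iff simp_thms)
qed simp_all

lemma periodic_stripes_not_bit: "periodic_stripes f {c \<in> cells. \<not> bit (f c) k}"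
  by (rule periodic_stripesI[of "2 ^ k" "2 ^ Suc k" 0])
    (auto simp: bit_iff_upper_half)

section \<open>Lattices of triangles\<close>

text \<open>Both residues are below \<open>2\<^sup>k\<close>, so their sum is the residue of \<open>n\<close> without reduction.\<close>

lemma position_lattice_residues:
  "position_lattice k =
     {(n, i, j) \<in> cells. i mod 2 ^ Suc k < 2 ^ k \<and> j mod 2 ^ Suc k < 2 ^ k
        \<and> 2 ^ k \<le> i mod 2 ^ Suc k + j mod 2 ^ Suc k}"
proof -
  have "bit (i + j) k \<longleftrightarrow> 2 ^ k \<le> i mod 2 ^ Suc k + j mod 2 ^ Suc k"
    if "i mod 2 ^ Suc k < 2 ^ k" "j mod 2 ^ Suc k < 2 ^ k" for i j :: nat
  proof -
    have "i mod 2 ^ Suc k + j mod 2 ^ Suc k < 2 ^ Suc k"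
      using that by simp
    then have "(i + j) mod 2 ^ Suc k = i mod 2 ^ Suc k + j mod 2 ^ Suc k"
      by (metis mod_add_eq mod_less)
    then show ?thesis
      by (simp only: bit_iff_upper_half)
  qed
  then show ?thesis
    unfolding position_lattice_def cells_def
    by (auto simp only: bit_iff_upper_half[of i k for i] not_le)
qed

lemma in_shift_image_iff:
  "(n, i, j) \<in> shift u v ` T \<longleftrightarrow> (\<exists>n' i' j'. (n', i', j') \<in> T \<and> n = n' + u + v \<and> i = i' + u \<and> j = j' + v)"
  by force

text \<open>If a block fits into one period in both diagonal directions, its lattice is cut out by the
  residues, and the quotients identify the copy to which a cell belongs.\<close>

lemma lattice_of_trianglesI:
  assumes T: "triangular_block T" "T \<subseteq> cells"
    and small: "\<And>n i j. (n, i, j) \<in> T \<Longrightarrow> i < p \<and> j < p"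
    and "0 < p"
    and L: "L = {(n, i, j) \<in> cells. (i mod p + j mod p, i mod p, j mod p) \<in> T}"
  shows "lattice_of_triangles L"
proof -
  have iff: "(n, i, j) \<in> shift (x * p) (y * p) ` T \<longleftrightarrow> (n, i, j) \<in> L \<and> x = i div p \<and> y = j div p"
    for n i j x y
  proof
    assume "(n, i, j) \<in> shift (x * p) (y * p) ` T"
    then obtain n' i' j' where t: "(n', i', j') \<in> T"
      and e: "n = n' + x * p + y * p" "i = i' + x * p" "j = j' + y * p"
      unfolding in_shift_image_iff by blast
    from t T(2) have "n' = i' + j'"
      by (auto simp: cells_def)
    with t e small[OF t] show "(n, i, j) \<in> L \<and> x = i div p \<and> y = j div p"
      by (simp add: L cells_def)
  next
    assume a: "(n, i, j) \<in> L \<and> x = i div p \<and> y = j div p"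
    then have "(i mod p + j mod p, i mod p, j mod p) \<in> T" "n = i + j"
      by (simp_all add: L cells_def)
    moreover have "i = i mod p + x * p" "j = j mod p + y * p"
      using a by simp_all
    ultimately show "(n, i, j) \<in> shift (x * p) (y * p) ` T"
      unfolding in_shift_image_iff
      by (intro exI[of _ "i mod p + j mod p"] exI[of _ "i mod p"] exI[of _ "j mod p"]) linarith
  qed
  have "disjoint_family (\<lambda>(x, y). shift (x * p) (y * p) ` T)"
  proof -
    have same: "x = x' \<and> y = y'"
      if "c \<in> shift (x * p) (y * p) ` T" "c \<in> shift (x' * p) (y' * p) ` T" for c x y x' y'
      using that by (cases c) (simp only: iff)
    have "shift (x * p) (y * p) ` T \<inter> shift (x' * p) (y' * p) ` T = {}"
      if "(x, y) \<noteq> (x', y')" for x y x' y'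
      using same that by (intro equals0I) (metis IntE)
    then show ?thesis
      unfolding disjoint_family_on_def by (simp only: ball_UNIV split_paired_All prod.case) blast
  qed
  moreover have "L = (\<Union>(x, y). shift (x * p) (y * p) ` T)"
  proof (intro set_eqI)
    fix c :: cell
    obtain n i j where "c = (n, i, j)"
      by (metis prod_cases3)
    then show "c \<in> L \<longleftrightarrow> c \<in> (\<Union>(x, y). shift (x * p) (y * p) ` T)"
      by (simp add: iff split_beta)
  qed
  ultimately show ?thesis
    using T(1) \<open>0 < p\<close> unfolding lattice_of_triangles_def by blast
qed

lemma lattice_position_lattice:
  assumes "1 \<le> k"
  shows "lattice_of_triangles (position_lattice k)"
proof -
  define T :: "cell set" where
    "T = {(n, i, j) \<in> cells. i \<le> 2 ^ k - 1 \<and> j \<le> 2 ^ k - 1 \<and> 2 ^ k \<le> n}"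
  \<comment> \<open>This is where \<open>k \<noteq> 0\<close> enters: in the 1's place \<open>T\<close> is empty.\<close>
  have "(2::nat) ^ 1 \<le> 2 ^ k"
    using assms by (intro power_increasing) auto
  then have "(2::nat) ^ k \<le> (2 ^ k - 1) + (2 ^ k - 1)"
    by simp
  then have "triangular_block T"
    unfolding triangular_block_def down_triangle_def T_def
    by (intro disjI2 exI[of _ "2 ^ k - 1"] exI[of _ "2 ^ k"] conjI) auto
  moreover have le: "m \<le> 2 ^ k - 1 \<longleftrightarrow> m < 2 ^ k" for m :: nat
    using zero_less_power[of "2::nat" k] by linarith
  ultimately show ?thesis
  proof (intro lattice_of_trianglesI[of T "2 ^ Suc k"])
    show "position_lattice k = {(n, i, j) \<in> cells.
        (i mod 2 ^ Suc k + j mod 2 ^ Suc k, i mod 2 ^ Suc k, j mod 2 ^ Suc k) \<in> T}"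
      unfolding position_lattice_residues T_def cells_def by (simp only: le mem_Collect_eq prod.case simp_thms)
  next
    fix n i j
    assume "(n, i, j) \<in> T"
    then have "i < 2 ^ k" "j < 2 ^ k"
      by (auto simp only: T_def le mem_Collect_eq prod.case)
    then show "i < 2 ^ Suc k \<and> j < 2 ^ Suc k"
      by simp
  qed (auto simp: T_def)
qed

section \<open>Carries\<close>

lemma carry_into_le_1: "carry_into i j k \<le> 1"
  by (induction k) auto

lemma carry_into_eq_0:
  assumes "i + j < 2 ^ k"
  shows "carry_into i j k = 0"
  using carry_into_div[of i j k] assms by simp

text \<open>Look at the lowest position that receives a carry.\<close>

lemma has_carry_iff_common_bit: "has_carry i j \<longleftrightarrow> (\<exists>k. bit i k \<and> bit j k)"
proof
  assume "has_carry i j"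
  then have ex: "\<exists>k. carry_into i j k \<noteq> 0"
    unfolding has_carry_def by (metis zero_neq_one)
  define k where "k = (LEAST k. carry_into i j k \<noteq> 0)"
  have "carry_into i j k \<noteq> 0"
    unfolding k_def by (rule LeastI_ex[OF ex])
  then obtain m where m: "k = Suc m"
    by (cases k) auto
  then have "carry_into i j m = 0"
    using not_less_Least[of m "\<lambda>k. carry_into i j k \<noteq> 0"] by (simp add: k_def)
  with \<open>carry_into i j k \<noteq> 0\<close> m show "\<exists>k. bit i k \<and> bit j k"
    by (intro exI[of _ m]) (auto split: if_splits simp: of_bool_def)
next
  assume "\<exists>k. bit i k \<and> bit j k"
  then obtain k where "bit i k" "bit j k"
    by blast
  then have "carry_into i j (Suc k) = 1"
    using carry_into_le_1[of i j k] by simp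
  then show "has_carry i j"
    unfolding has_carry_def ..
qed

text \<open>Carries die out, so there is a highest position that receives one; since it passes none on,
  it absorbs its carry.\<close>

lemma has_carry_iff_zero_zero_one:
  "has_carry i j \<longleftrightarrow> (\<exists>k. \<not> bit i k \<and> \<not> bit j k \<and> bit (i + j) k)"
proof
  assume "has_carry i j"
  then obtain k where k: "carry_into i j k = 1"
    unfolding has_carry_def by blast
  have "k \<le> i + j" if "carry_into i j k = 1" for k
  proof (rule ccontr)
    assume "\<not> k \<le> i + j"
    then have "i + j < 2 ^ k"
      by (meson less_exp less_trans not_le)
    with that show False
      by (simp add: carry_into_eq_0)
  qed
  then obtain m where m: "carry_into i j m = 1"
    and max: "\<And>l. carry_into i j l = 1 \<Longrightarrow> l \<le> m"
    using Nat.ex_has_greatest_nat[of "\<lambda>k. carry_into i j k = 1" k "i + j"] k by blast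
  have "(digit i m + digit j m + 1) div 2 \<noteq> 1"
    using max[of "Suc m"] m by auto
  then have "\<not> bit i m" "\<not> bit j m"
    by (auto simp: of_bool_def split: if_splits)
  moreover from this have "bit (i + j) m"
    using digit_add[of i j m] m by (metis add_0 of_bool_eq(1) of_bool_eq_1_iff one_mod_two_eq_one)
  ultimately show "\<exists>k. \<not> bit i k \<and> \<not> bit j k \<and> bit (i + j) k"
    by blast
next
  assume "\<exists>k. \<not> bit i k \<and> \<not> bit j k \<and> bit (i + j) k"
  then obtain k where "\<not> bit i k" "\<not> bit j k" "bit (i + j) k"
    by blast
  then have "carry_into i j k mod 2 = 1"
    using digit_add[of i j k] by simp
  then have "carry_into i j k = 1"
    using carry_into_le_1[of i j k] by (auto simp: le_Suc_eq)
  then show "has_carry i j"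
    unfolding has_carry_def ..
qed

section \<open>Parity of binomial coefficients\<close>

text \<open>This is Lucas' theorem for the prime \<open>2\<close>, one digit at a time. Applying Pascal's rule twice
  gives \<open>C(n + 2, r + 2) = C(n, r) + 2 C(n, r + 1) + C(n, r + 2)\<close>; modulo \<open>2\<close> the middle term
  disappears, and what is left is Pascal's rule for the halves.\<close>

lemma even_choose_halve:
  "even (n choose r) \<longleftrightarrow> even n \<and> odd r \<or> even ((n div 2) choose (r div 2))"
proof (induction n arbitrary: r rule: induct_nat_012)
  case 0
  show ?case
    by (cases r; cases "r - 1") auto
next
  case 1
  show ?case
    by (cases r; cases "r - 1") auto
next
  case (ge2 n)
  consider "r = 0" | "r = 1" | s where "r = Suc (Suc s)"
    by (metis One_nat_def not0_implies_Suc)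
  then show ?case
  proof cases
    case (3 s)
    have "Suc (Suc n) choose r = (n choose s) + 2 * (n choose Suc s) + (n choose Suc (Suc s))"
      unfolding 3 by simp
    then have "even (Suc (Suc n) choose r) \<longleftrightarrow> (even (n choose s) \<longleftrightarrow> even (n choose Suc (Suc s)))"
      by simp
    then show ?thesis
      unfolding 3 by (auto simp: ge2.IH(1))
  qed simp_all
qed

lemma even_choose_iff_common_bit: "even ((i + j) choose i) \<longleftrightarrow> (\<exists>k. bit i k \<and> bit j k)"
proof (induction i arbitrary: j rule: less_induct)
  case (less i)
  show ?case
  proof (cases "i = 0")
    case False
    then have IH: "even ((i div 2 + j div 2) choose (i div 2)) \<longleftrightarrow> (\<exists>k. bit (i div 2) k \<and> bit (j div 2) k)"
      by (intro less.IH) simp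
    have step: "(\<exists>k. bit i k \<and> bit j k) \<longleftrightarrow> odd i \<and> odd j \<or> (\<exists>k. bit (i div 2) k \<and> bit (j div 2) k)"
      by (metis bit_0 bit_Suc not0_implies_Suc)
    have "(i + j) div 2 = i div 2 + j div 2" if "\<not> (odd i \<and> odd j)"
      using that by (auto simp: div_plus_div_distrib_dvd_left div_plus_div_distrib_dvd_right)
    then show ?thesis
      unfolding even_choose_halve[of "i + j" i] step using IH by auto
  qed simp
qed

section \<open>Even entries, lattices and carries\<close>

theorem mainTheorem1:
  shows "(\<forall>k. periodic_stripes row_index (row_stripes k)
              \<and> periodic_stripes nwse_index (nwse_stripes k)
              \<and> periodic_stripes nesw_index (nesw_stripes k))
       \<and> (\<forall>k. position_lattice k = row_stripes k \<inter> nwse_stripes k \<inter> nesw_stripes k)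
       \<and> position_lattice 0 = {}
       \<and> (\<forall>k\<ge>1. lattice_of_triangles (position_lattice k))
       \<and> {c \<in> cells. even (entry c)} = (\<Union>k. position_lattice k)
       \<and> (\<Union>k. position_lattice k)
           = {(n, i, j) \<in> cells. \<exists>k. \<not> bit i k \<and> \<not> bit j k \<and> bit n k}
       \<and> {(n, i, j) \<in> cells. \<exists>k. \<not> bit i k \<and> \<not> bit j k \<and> bit n k}
           = {(n, i, j) \<in> cells. has_carry i j}
       \<and> {(n, i, j) \<in> cells. has_carry i j} = {c \<in> cells. even (entry c)}"
proof -
  have stripes: "\<forall>k. periodic_stripes row_index (row_stripes k)
      \<and> periodic_stripes nwse_index (nwse_stripes k)
      \<and> periodic_stripes nesw_index (nesw_stripes k)"
    unfolding row_stripes_def nwse_stripes_def nesw_stripes_def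
    by (intro allI conjI periodic_stripes_bit periodic_stripes_not_bit)
  have inter: "\<forall>k. position_lattice k = row_stripes k \<inter> nwse_stripes k \<inter> nesw_stripes k"
    unfolding position_lattice_def row_stripes_def nwse_stripes_def nesw_stripes_def by auto
  have zero: "position_lattice 0 = {}"
    unfolding position_lattice_def cells_def by (auto simp: bit_0)
  have union: "(\<Union>k. position_lattice k)
      = {(n, i, j) \<in> cells. \<exists>k. \<not> bit i k \<and> \<not> bit j k \<and> bit n k}"
    unfolding position_lattice_def by auto
  have ends: "{(n, i, j) \<in> cells. \<exists>k. \<not> bit i k \<and> \<not> bit j k \<and> bit n k}
      = {(n, i, j) \<in> cells. has_carry i j}"
    unfolding cells_def by (auto simp only: has_carry_iff_zero_zero_one)
  have starts: "{(n, i, j) \<in> cells. has_carry i j} = {c \<in> cells. even (entry c)}"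
  proof -
    have "even (entry (n, i, j)) \<longleftrightarrow> has_carry i j" if "(n, i, j) \<in> cells" for n i j
      using that entry_exact(2)[OF that] even_choose_iff_common_bit[of i j]
      by (simp add: cells_def has_carry_iff_common_bit)
    then show ?thesis
      by (auto simp del: entry.simps)
  qed
  show ?thesis
    using stripes inter zero lattice_position_lattice union ends starts by simp
qed

end
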